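(* Let $G=(V_G,E_G)$ be a finite connected weighted graph as described in the context. For every divisor $D$ on $G$ there exists a total order $O$ on $V_G$ such that exactly one of the linear systems $|D|$ and $|\nu_O-D|$ is empty.
   Context: $G=(V_G,E_G)$ is a connected graph with finite vertex set, no loops, edges unordered pairs of distinct vertices, each edge $\{x,y\}$ with positive rational weight $C_{x,y}=C_{y,x}$; $N(x)=\{y:\{x,y\}\in E_G\}$. For $f:V_G\to\mathbb Z$, $\Delta f(x)=\sum_{y\in N(x)}C_{x,y}(f(x)-f(y))$. $i(x)=\min\{|\Delta f(x)|: f:V_G\to\mathbb Z,\ f(x)=0,\ \Delta f(x)\ne0\}$. A divisor is $D=\sum_x\ell(x)i(x)1_{\{x\}}$ with $\ell:V_G\to\mathbb Z$; it is effective if $\ell\ge0$. $D\sim D'$ iff $D'=D+\Delta f$ for some $f:V_G\to\mathbb Z$ (with $\Delta f$ viewed as a divisor). $|D|=\{D': D'\text{ effective},\ D'\sim D\}$. For a total order $O$ on $V_G$, $\nu_O=\sum_x\big(\sum_{y\in N(x),\,y<_Ox}C_{x,y}-i(x)\big)1_{\{x\}}$. *)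

theory Defs
  imports Complex_Main "HOL-Library.Indicator_Function"
begin

locale weighted_graph =
  fixes V :: "'a set" and E :: "'a set set" and C :: "'a \<Rightarrow> 'a \<Rightarrow> rat"
  assumes finite_vertices: "finite V"
    and nonempty_vertices: "V \<noteq> {}"
    and edges: "e \<in> E \<Longrightarrow> \<exists>x\<in>V. \<exists>y\<in>V. x \<noteq> y \<and> e = {x, y}"
    and connected: "x \<in> V \<Longrightarrow> y \<in> V \<Longrightarrow> (x, y) \<in> {(u, v). {u, v} \<in> E}\<^sup>*"
    and weight_pos: "{x, y} \<in> E \<Longrightarrow> 0 < C x y"
    and weight_sym: "{x, y} \<in> E \<Longrightarrow> C x y = C y x"

definition nbrs :: "'a set set \<Rightarrow> 'a \<Rightarrow> 'a set"
  where "nbrs E x = {y. {x, y} \<in> E}"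

definition laplacian :: "'a set set \<Rightarrow> ('a \<Rightarrow> 'a \<Rightarrow> rat) \<Rightarrow> ('a \<Rightarrow> int) \<Rightarrow> 'a \<Rightarrow> rat"
  where "laplacian E C f x = (\<Sum>y\<in>nbrs E x. C x y * of_int (f x - f y))"

definition unit_candidates :: "'a set set \<Rightarrow> ('a \<Rightarrow> 'a \<Rightarrow> rat) \<Rightarrow> 'a \<Rightarrow> rat set"
  where "unit_candidates E C x =
    {\<bar>laplacian E C f x\<bar> | f :: 'a \<Rightarrow> int. f x = 0 \<and> laplacian E C f x \<noteq> 0}"

text \<open>
  The set of candidates is empty only at a vertex without neighbours, which in a connected
  graph means that this vertex is the only one. The minimum is then undefined; we
  use the value 1, so that divisors on the one-vertex graph are the integers.
\<close>
definition unit_at :: "'a set set \<Rightarrow> ('a \<Rightarrow> 'a \<Rightarrow> rat) \<Rightarrow> 'a \<Rightarrow> rat"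
  where "unit_at E C x =
    (if unit_candidates E C x = {} then 1 else (LEAST r. r \<in> unit_candidates E C x))"

definition divisor_of :: "'a set \<Rightarrow> 'a set set \<Rightarrow> ('a \<Rightarrow> 'a \<Rightarrow> rat) \<Rightarrow> ('a \<Rightarrow> int) \<Rightarrow> 'a \<Rightarrow> rat"
  where "divisor_of V E C l = (\<lambda>v. \<Sum>x\<in>V. of_int (l x) * unit_at E C x * indicator {x} v)"

definition divisor :: "'a set \<Rightarrow> 'a set set \<Rightarrow> ('a \<Rightarrow> 'a \<Rightarrow> rat) \<Rightarrow> ('a \<Rightarrow> rat) \<Rightarrow> bool"
  where "divisor V E C D \<longleftrightarrow> (\<exists>l. D = divisor_of V E C l)"

definition effective :: "'a set \<Rightarrow> 'a set set \<Rightarrow> ('a \<Rightarrow> 'a \<Rightarrow> rat) \<Rightarrow> ('a \<Rightarrow> rat) \<Rightarrow> bool"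
  where "effective V E C D \<longleftrightarrow> (\<exists>l. (\<forall>x\<in>V. 0 \<le> l x) \<and> D = divisor_of V E C l)"

definition lin_equiv :: "'a set set \<Rightarrow> ('a \<Rightarrow> 'a \<Rightarrow> rat) \<Rightarrow> ('a \<Rightarrow> rat) \<Rightarrow> ('a \<Rightarrow> rat) \<Rightarrow> bool"
  where "lin_equiv E C D D' \<longleftrightarrow> (\<exists>f :: 'a \<Rightarrow> int. D' = (\<lambda>x. D x + laplacian E C f x))"

definition linear_system ::
    "'a set \<Rightarrow> 'a set set \<Rightarrow> ('a \<Rightarrow> 'a \<Rightarrow> rat) \<Rightarrow> ('a \<Rightarrow> rat) \<Rightarrow> ('a \<Rightarrow> rat) set"
  where "linear_system V E C D = {D'. effective V E C D' \<and> lin_equiv E C D' D}"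

definition nu ::
    "'a set \<Rightarrow> 'a set set \<Rightarrow> ('a \<Rightarrow> 'a \<Rightarrow> rat) \<Rightarrow> 'a rel \<Rightarrow> 'a \<Rightarrow> rat"
  where "nu V E C R = (\<lambda>v. \<Sum>x\<in>V.
    ((\<Sum>y\<in>{y \<in> nbrs E x. (y, x) \<in> R \<and> y \<noteq> x}. C x y) - unit_at E C x) * indicator {x} v)"

text \<open>The minimum defining \<open>unit_at\<close> is attained, the weights being rational.\<close>
lemma (in weighted_graph) unit_at_minimum:
  assumes "unit_candidates E C x \<noteq> {}"
  shows "unit_at E C x \<in> unit_candidates E C x"
    and "r \<in> unit_candidates E C x \<Longrightarrow> unit_at E C x \<le> r"
proof -
  have "nbrs E x \<subseteq> V"
    using edges unfolding nbrs_def by (fastforce simp: doubleton_eq_iff)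
  then have fin: "finite (nbrs E x)"
    using finite_vertices finite_subset by blast
  define d where "d y = snd (quotient_of (C x y))" for y
  define N where "N = (\<Prod>y\<in>nbrs E x. d y)"
  have dpos: "d y > 0" for y
    unfolding d_def using quotient_of_denom_pos' by blast
  have Npos: "N > 0"
    unfolding N_def by (intro prod_pos) (use dpos in auto)
  have int_C: "of_int N * C x y \<in> \<int>" if y: "y \<in> nbrs E x" for y
  proof -
    obtain k where k: "N = d y * k"
      using dvd_prodI[OF fin y, of d] unfolding N_def by (auto elim: dvdE)
    have "C x y = of_int (fst (quotient_of (C x y))) / of_int (d y)"
      unfolding d_def by (metis prod.collapse quotient_of_div)
    then have "of_int N * C x y = of_int (k * fst (quotient_of (C x y)))"
      using dpos[of y] k by (simp add: field_simps)
    then show ?thesis by (metis Ints_of_int)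
  qed
  have int_L: "of_int N * r \<in> \<int>" if "r \<in> unit_candidates E C x" for r
  proof -
    from that obtain f :: "'a \<Rightarrow> int" where r: "r = \<bar>laplacian E C f x\<bar>"
      unfolding unit_candidates_def by blast
    have "of_int N * laplacian E C f x =
        (\<Sum>y\<in>nbrs E x. (of_int N * C x y) * of_int (f x - f y))"
      unfolding laplacian_def by (simp add: sum_distrib_left mult.assoc)
    also have "\<dots> \<in> \<int>"
      by (rule Ints_sum, rule Ints_mult[OF int_C]) (simp_all only: Ints_of_int)
    finally show ?thesis
      unfolding r by (simp add: abs_if)
  qed
  define m where "m r = nat \<lfloor>of_int N * r\<rfloor>" for r :: rat
  obtain a where a: "a \<in> unit_candidates E C x"
      and amin: "\<And>r. r \<in> unit_candidates E C x \<Longrightarrow> m a \<le> m r"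
    using assms ex_has_least_nat[of "\<lambda>r. r \<in> unit_candidates E C x" _ m] by blast
  have le: "a \<le> r" if r: "r \<in> unit_candidates E C x" for r
  proof -
    have "a \<ge> 0" "r \<ge> 0"
      using a r unfolding unit_candidates_def by auto
    then have "0 \<le> \<lfloor>of_int N * a\<rfloor>" "0 \<le> \<lfloor>of_int N * r\<rfloor>"
      using Npos by auto
    then have "\<lfloor>of_int N * a\<rfloor> \<le> \<lfloor>of_int N * r\<rfloor>"
      using amin[OF r] unfolding m_def by linarith
    then have "of_int N * a \<le> of_int N * r"
      using int_L[OF a] int_L[OF r] by (auto elim!: Ints_cases)
    then show ?thesis
      using Npos by simp
  qed
  have eq: "unit_at E C x = a"
    unfolding unit_at_def using assms a le by (auto intro: Least_equality)
  show "unit_at E C x \<in> unit_candidates E C x"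
    unfolding eq by (rule a)
  show "unit_at E C x \<le> r" if "r \<in> unit_candidates E C x"
    unfolding eq by (rule le[OF that])
qed

end

theory Submission
  imports Defs
begin

text \<open>
  Fix a vertex \<open>q\<close>. Every divisor is equivalent to a \<open>q\<close>-reduced one \<open>F\<close>: nonnegative off \<open>q\<close>, and such that
  firing any nonempty set of vertices avoiding \<open>q\<close> makes some value negative. If \<open>F q \<ge> 0\<close> then
  \<open>|D|\<close> is nonempty. Otherwise Dhar's burning process started at \<open>q\<close> burns the whole graph, and in the
  order of burning \<open>F x\<close> is smaller than the weight towards earlier vertices, hence
  smaller by at least one unit, so \<open>\<nu> - F\<close> is effective. The two systems are never both nonempty,
  because no effective divisor is equivalent to \<open>\<nu>\<close>.
\<close>

section \<open>Common denominators and finite linear orders\<close>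

text \<open>Scaling by such an \<open>N\<close> turns a rational quantity built from
  \<open>g\<close> into an integer, so that a least value can be sought among natural
  numbers.\<close>

lemma common_denominator:
  fixes g :: "'b \<Rightarrow> rat"
  assumes "finite A"
  shows "\<exists>N::int. 0 < N \<and> (\<forall>x\<in>A. of_int N * g x \<in> \<int>)"
  using assms
proof (induction A)
  case empty
  show ?case by (auto intro: exI[of _ 1])
next
  case (insert a A)
  then obtain N :: int where N: "0 < N" "\<And>x. x \<in> A \<Longrightarrow> of_int N * g x \<in> \<int>"
    by blast
  obtain p d where pd: "quotient_of (g a) = (p, d)"
    by (cases "quotient_of (g a)")
  have d: "0 < d" and ga: "g a = of_int p / of_int d"
    using quotient_of_denom_pos[OF pd] quotient_of_div[OF pd] by auto
  have "of_int (d * N) * g a = of_int (p * N)"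
    using d ga by simp
  then have "of_int (d * N) * g a \<in> \<int>"
    by (metis Ints_of_int)
  moreover have "of_int (d * N) * g x \<in> \<int>" if "x \<in> A" for x
    using Ints_mult[OF Ints_of_int[of d] N(2)[OF that]] by (simp add: mult.assoc)
  ultimately show ?case
    using N(1) d by (intro exI[of _ "d * N"]) auto
qed

lemma linear_order_on_insert_bottom:
  assumes "linear_order_on A R" "a \<notin> A"
  shows "linear_order_on (insert a A) (R \<union> {a} \<times> insert a A)"
  using assms
  unfolding linear_order_on_def partial_order_on_def preorder_on_def refl_on_def
    total_on_def antisym_def trans_def
  by blast

lemma linear_order_on_has_least:
  assumes "linear_order_on A R" "finite M" "M \<noteq> {}" "M \<subseteq> A"
  shows "\<exists>x\<in>M. \<forall>y\<in>M. (x, y) \<in> R"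
  using assms(2,3,4)
proof (induction M rule: finite_ne_induct)
  case (singleton x)
  then show ?case
    using assms(1)
    unfolding linear_order_on_def partial_order_on_def preorder_on_def refl_on_def by auto
next
  case (insert z M)
  then obtain x where x: "x \<in> M" "\<forall>y\<in>M. (x, y) \<in> R"
    by auto
  have "x \<in> A" "z \<in> A" "x \<noteq> z"
    using insert.prems insert.hyps x(1) by auto
  then have R: "trans R" "(z, z) \<in> R" "(x, z) \<in> R \<or> (z, x) \<in> R"
    using assms(1)
    unfolding linear_order_on_def partial_order_on_def preorder_on_def refl_on_def total_on_def
    by auto
  from R(3) show ?case
  proof
    assume "(x, z) \<in> R"
    then show ?thesis using x by auto
  next
    assume zx: "(z, x) \<in> R"
    have "(z, y) \<in> R" if "y \<in> M" for y
      using transD[OF R(1) zx] x(2) that by auto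
    then show ?thesis using R(2) by auto
  qed
qed

context weighted_graph
begin

abbreviation lap :: "('a \<Rightarrow> int) \<Rightarrow> 'a \<Rightarrow> rat"
  where "lap \<equiv> laplacian E C"

abbreviation unit :: "'a \<Rightarrow> rat"
  where "unit \<equiv> unit_at E C"

section \<open>Neighbourhoods, the Laplacian and Green's identity\<close>

lemma nbrs_subset: "nbrs E x \<subseteq> V"
  using edges unfolding nbrs_def by (fastforce simp: doubleton_eq_iff)

lemma finite_nbrs: "finite (nbrs E x)"
  using nbrs_subset finite_vertices finite_subset by blast

lemma nbrs_sym: "y \<in> nbrs E x \<longleftrightarrow> x \<in> nbrs E y"
  by (simp add: nbrs_def insert_commute)

lemma not_nbrs_self: "x \<notin> nbrs E x"
  using edges[of "{x, x}"] by (auto simp: nbrs_def doubleton_eq_iff)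

lemma nbrs_weight_pos: "y \<in> nbrs E x \<Longrightarrow> 0 < C x y"
  by (simp add: nbrs_def weight_pos)

lemma lap_outside: "x \<notin> V \<Longrightarrow> lap f x = 0"
proof -
  assume "x \<notin> V"
  then have "nbrs E x = {}"
    using nbrs_sym[of _ x] nbrs_subset by auto
  then show ?thesis by (simp add: laplacian_def)
qed

lemma lap_add: "lap (\<lambda>v. f v + g v) x = lap f x + lap g x"
  by (simp add: laplacian_def algebra_simps sum.distrib sum_subtractf)

lemma lap_scale: "lap (\<lambda>v. k * f v) x = of_int k * lap f x"
  by (simp add: laplacian_def sum_distrib_left algebra_simps)

lemma lap_diff: "lap (\<lambda>v. f v - g v) x = lap f x - lap g x"
  using lap_add[of f "\<lambda>v. -1 * g v" x] lap_scale[of "-1" g x] by simp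

lemma lap_uminus: "lap (\<lambda>v. - f v) x = - lap f x"
  using lap_scale[of "-1" f x] by simp

lemma lap_shift: "lap (\<lambda>v. f v - k) x = lap f x"
  by (simp add: laplacian_def)

text \<open>The Laplacian is self-adjoint because the weights are symmetric: the diagonal terms
  agree, and the cross terms agree after swapping the two summations.\<close>

lemma lap_green: "(\<Sum>x\<in>V. lap f x * of_int (g x)) = (\<Sum>x\<in>V. of_int (f x) * lap g x)"
proof -
  \<comment> \<open>Extending the weights by zero makes both sums range over \<open>V\<close>, so
    they can be swapped.\<close>
  define W where "W x y = (if y \<in> nbrs E x then C x y else 0)" for x y
  have W_sym: "W x y = W y x" for x y
    using weight_sym by (auto simp: W_def nbrs_def insert_commute)
  have lapW: "lap f x = (\<Sum>y\<in>V. W x y * of_int (f x - f y))" for f x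
    unfolding laplacian_def W_def
    by (rule sum.mono_neutral_cong_left) (use finite_vertices nbrs_subset in auto)
  have "(\<Sum>x\<in>V. \<Sum>y\<in>V. W x y * of_int (f y) * of_int (g x)) =
      (\<Sum>x\<in>V. \<Sum>y\<in>V. W x y * of_int (f x) * of_int (g y))"
    by (subst sum.swap) (simp add: W_sym)
  then show ?thesis
    unfolding lapW
    by (simp add: sum_distrib_left sum_distrib_right sum_subtractf algebra_simps)
qed

section \<open>Divisibility by the unit of a vertex\<close>

lemma unit_pos: "0 < unit x"
proof (cases "unit_candidates E C x = {}")
  case True
  then show ?thesis by (simp add: unit_at_def)
next
  case False
  then show ?thesis
    using unit_at_minimum(1)[OF False] by (auto simp: unit_candidates_def)
qed

text \<open>Division with remainder: the values of the Laplacian at \<open>x\<close> form a subgroup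
  of the rationals whose least positive element is \<open>unit x\<close>. Shifting by a constant
  removes the condition \<open>f x = 0\<close> from the candidates.\<close>

lemma lap_unit_multiple: "\<exists>k::int. lap f x = of_int k * unit x"
proof (cases "unit_candidates E C x = {}")
  case True
  then have "lap (\<lambda>v. f v - f x) x = 0"
    unfolding unit_candidates_def by auto
  then show ?thesis
    unfolding lap_shift by (intro exI[of _ 0]) simp
next
  case False
  obtain g where g: "lap g x = unit x"
  proof -
    \<comment> \<open>The minimum is attained in absolute value; if the sign is wrong,
      \<open>- g\<close> serves instead.\<close>
    obtain g where "unit x = \<bar>lap g x\<bar>"
      using unit_at_minimum(1)[OF False] by (auto simp: unit_candidates_def)
    then show ?thesis
      using that by (metis abs_if lap_uminus)
  qed
  define k where "k = \<lfloor>lap f x / unit x\<rfloor>"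
  define r where "r v = f v - k * g v" for v
  have lapr: "lap r x = lap f x - of_int k * unit x"
    unfolding r_def using g by (simp add: lap_diff lap_scale)
  have "of_int k \<le> lap f x / unit x" "lap f x / unit x < of_int k + 1"
    unfolding k_def by linarith+
  then have r: "0 \<le> lap r x" "lap r x < unit x"
    unfolding lapr using unit_pos[of x] by (simp_all add: field_simps)
  have "lap r x = 0"
  proof (rule ccontr)
    assume "lap r x \<noteq> 0"
    \<comment> \<open>A nonzero remainder would be a candidate below the minimum.\<close>
    then have "\<bar>lap r x\<bar> \<in> unit_candidates E C x"
      unfolding unit_candidates_def
      by (auto simp: lap_shift intro!: exI[of _ "\<lambda>v. r v - r x"])
    from unit_at_minimum(2)[OF False this] r show False by simp
  qed
  then show ?thesis using lapr by auto
qed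

lemma lap_indicator_inside:
  assumes "x \<in> A"
  shows "lap (\<lambda>v. if v \<in> A then 1 else 0) x = (\<Sum>y\<in>nbrs E x - A. C x y)"
  unfolding laplacian_def
  by (rule sum.mono_neutral_cong_right) (use assms finite_nbrs in auto)

lemma lap_indicator_outside:
  assumes "x \<notin> A"
  shows "lap (\<lambda>v. if v \<in> A then 1 else 0) x = - (\<Sum>y\<in>nbrs E x \<inter> A. C x y)"
  unfolding laplacian_def sum_negf[symmetric]
  by (rule sum.mono_neutral_cong_right) (use assms finite_nbrs in auto)

text \<open>The Laplacian at \<open>x\<close> of the indicator of a neighbour \<open>y\<close> is
  \<open>- C x y\<close>, so the weights inherit the divisibility of Laplacians.\<close>

lemma weight_unit_multiple:
  assumes "y \<in> nbrs E x"
  shows "\<exists>k::int. C x y = of_int k * unit x"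
proof -
  obtain k :: int where k: "lap (\<lambda>v. if v \<in> {y} then 1 else 0) x = of_int k * unit x"
    using lap_unit_multiple by blast
  have "x \<notin> {y}" "nbrs E x \<inter> {y} = {y}"
    using assms not_nbrs_self by auto
  then have "lap (\<lambda>v. if v \<in> {y} then 1 else 0) x = - C x y"
    using lap_indicator_outside[of x "{y}"] by simp
  then have "C x y = of_int (- k) * unit x"
    using k by simp
  then show ?thesis by blast
qed

lemma weight_sum_unit_multiple:
  assumes "B \<subseteq> nbrs E x"
  shows "\<exists>k::int. (\<Sum>y\<in>B. C x y) = of_int k * unit x"
proof -
  have "\<forall>y\<in>B. \<exists>k::int. C x y = of_int k * unit x"
    using weight_unit_multiple assms by auto
  from bchoice[OF this]
  obtain k :: "'a \<Rightarrow> int" where k: "\<And>y. y \<in> B \<Longrightarrow> C x y = of_int (k y) * unit x"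
    by auto
  then have "(\<Sum>y\<in>B. C x y) = of_int (\<Sum>y\<in>B. k y) * unit x"
    by (simp add: sum_distrib_right)
  then show ?thesis by blast
qed

section \<open>Divisors and effective divisors\<close>

lemma divisor_of_apply: "divisor_of V E C l v = (if v \<in> V then of_int (l v) * unit v else 0)"
proof -
  have "divisor_of V E C l v = (\<Sum>x\<in>V. if v = x then of_int (l x) * unit x else 0)"
    unfolding divisor_of_def by (intro sum.cong) (auto simp: indicator_def)
  then show ?thesis
    using finite_vertices by simp
qed

text \<open>In this pointwise form closure properties can be checked vertex by vertex, without
  exhibiting a coefficient function.\<close>

lemma divisor_iff:
  "divisor V E C D \<longleftrightarrow> (\<forall>x. x \<notin> V \<longrightarrow> D x = 0) \<and> (\<forall>x\<in>V. \<exists>k::int. D x = of_int k * unit x)"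
proof
  assume "divisor V E C D"
  then show "(\<forall>x. x \<notin> V \<longrightarrow> D x = 0) \<and> (\<forall>x\<in>V. \<exists>k::int. D x = of_int k * unit x)"
    by (auto simp: divisor_def divisor_of_apply)
next
  assume *: "(\<forall>x. x \<notin> V \<longrightarrow> D x = 0) \<and> (\<forall>x\<in>V. \<exists>k::int. D x = of_int k * unit x)"
  then obtain l :: "'a \<Rightarrow> int" where "\<And>x. x \<in> V \<Longrightarrow> D x = of_int (l x) * unit x"
    by metis
  with * have "D = divisor_of V E C l"
    by (auto simp: divisor_of_apply fun_eq_iff)
  then show "divisor V E C D"
    unfolding divisor_def by blast
qed

lemma divisor_unit_multiple:
  assumes "divisor V E C D" "x \<in> V"
  shows "\<exists>k::int. D x = of_int k * unit x"
  using assms unfolding divisor_iff by blast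

lemma effective_iff: "effective V E C D \<longleftrightarrow> divisor V E C D \<and> (\<forall>x\<in>V. 0 \<le> D x)"
proof -
  have "0 \<le> of_int k * unit x \<longleftrightarrow> 0 \<le> k" for k :: int and x
    using unit_pos[of x] by (auto simp: zero_le_mult_iff)
  then have "(\<forall>x\<in>V. 0 \<le> divisor_of V E C l x) \<longleftrightarrow> (\<forall>x\<in>V. 0 \<le> l x)" for l
    by (simp add: divisor_of_apply)
  then show ?thesis
    unfolding effective_def divisor_def by metis
qed

lemma effective_add:
  assumes "effective V E C D" "effective V E C D'"
  shows "effective V E C (\<lambda>x. D x + D' x)"
proof -
  have "\<exists>k::int. D x + D' x = of_int k * unit x" if "x \<in> V" for x
  proof -
    obtain k k' :: int where "D x = of_int k * unit x" "D' x = of_int k' * unit x"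
      using assms \<open>x \<in> V\<close> unfolding effective_iff divisor_iff by blast
    then have "D x + D' x = of_int (k + k') * unit x"
      by (simp add: algebra_simps)
    then show ?thesis by blast
  qed
  then show ?thesis
    using assms unfolding effective_iff divisor_iff by auto
qed

lemma divisor_diff:
  assumes "divisor V E C D" "divisor V E C D'"
  shows "divisor V E C (\<lambda>x. D x - D' x)"
proof -
  have "\<exists>k::int. D x - D' x = of_int k * unit x" if "x \<in> V" for x
  proof -
    obtain k k' :: int where "D x = of_int k * unit x" "D' x = of_int k' * unit x"
      using assms \<open>x \<in> V\<close> unfolding divisor_iff by blast
    then have "D x - D' x = of_int (k - k') * unit x"
      by (simp add: algebra_simps)
    then show ?thesis by blast
  qed
  then show ?thesis
    using assms unfolding divisor_iff by auto
qed

lemma divisor_lap: "divisor V E C (lap f)"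
  unfolding divisor_iff using lap_outside lap_unit_multiple by blast

lemma divisor_add_lap:
  assumes "divisor V E C D"
  shows "divisor V E C (\<lambda>x. D x + lap f x)"
  using divisor_diff[OF assms divisor_lap[of "\<lambda>v. - f v"]] by (simp add: lap_uminus)

section \<open>The divisor of an order\<close>

lemma nu_apply:
  "nu V E C R v = (if v \<in> V
    then (\<Sum>y\<in>{y \<in> nbrs E v. (y, v) \<in> R \<and> y \<noteq> v}. C v y) - unit v else 0)"
proof -
  have "nu V E C R v = (\<Sum>x\<in>V. if v = x
      then (\<Sum>y\<in>{y \<in> nbrs E x. (y, x) \<in> R \<and> y \<noteq> x}. C x y) - unit x else 0)"
    unfolding nu_def by (intro sum.cong) (auto simp: indicator_def)
  then show ?thesis
    using finite_vertices by simp
qed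

lemma divisor_nu: "divisor V E C (nu V E C R)"
  unfolding divisor_iff
proof (intro conjI ballI allI impI)
  fix x assume "x \<in> V"
  obtain k :: int where "(\<Sum>y\<in>{y \<in> nbrs E x. (y, x) \<in> R \<and> y \<noteq> x}. C x y) = of_int k * unit x"
    using weight_sum_unit_multiple[of "{y \<in> nbrs E x. (y, x) \<in> R \<and> y \<noteq> x}" x] by auto
  with \<open>x \<in> V\<close> have "nu V E C R x = of_int (k - 1) * unit x"
    by (simp add: nu_apply algebra_simps)
  then show "\<exists>k::int. nu V E C R x = of_int k * unit x" by blast
qed (simp add: nu_apply)

text \<open>At the \<open>R\<close>-least minimum point of \<open>f\<close>, every smaller neighbour has a larger value of \<open>f\<close>,
  so \<open>lap f\<close> cancels the sum in \<open>nu\<close> and leaves at most \<open>- unit\<close>.\<close>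

lemma nu_add_lap_not_effective:
  assumes R: "linear_order_on V R"
  shows "\<not> effective V E C (\<lambda>x. nu V E C R x + lap f x)"
proof -
  define m where "m = Min (f ` V)"
  define M where "M = {x \<in> V. f x = m}"
  have m_le: "m \<le> f y" if "y \<in> V" for y
    unfolding m_def using finite_vertices that by simp
  have "m \<in> f ` V"
    unfolding m_def using finite_vertices nonempty_vertices by simp
  then have M: "finite M" "M \<noteq> {}" "M \<subseteq> V"
    unfolding M_def using finite_vertices by auto
  from linear_order_on_has_least[OF R this]
  obtain x where x: "x \<in> M" "\<And>y. y \<in> M \<Longrightarrow> (x, y) \<in> R"
    by blast
  have xV: "x \<in> V" and fx: "f x = m"
    using x(1) by (auto simp: M_def)
  define L where "L = {y \<in> nbrs E x. (y, x) \<in> R \<and> y \<noteq> x}"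
  have "antisym R"
    using R by (simp add: linear_order_on_def partial_order_on_def)
  then have above: "m < f y" if "y \<in> L" for y
  proof -
    \<comment> \<open>By antisymmetry, no other minimum point lies below the least one.\<close>
    have "y \<in> V" "y \<notin> M"
      using that x(2) nbrs_subset \<open>antisym R\<close> by (auto simp: L_def antisym_def)
    then show ?thesis
      using m_le[of y] by (auto simp: M_def)
  qed
  have "lap f x \<le> (\<Sum>y\<in>nbrs E x. if y \<in> L then - C x y else 0)"
    unfolding laplacian_def
  proof (rule sum_mono)
    fix y assume y: "y \<in> nbrs E x"
    then have C: "0 < C x y" and "m \<le> f y"
      using nbrs_weight_pos m_le nbrs_subset by blast+
    \<comment> \<open>Integrality enters here: a value above \<open>m\<close> exceeds it by at least
      1, so the term of each \<open>y\<close> in \<open>L\<close> is at most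
      \<open>- C x y\<close>.\<close>
    then have "(of_int (f x - f y) :: rat) \<le> (if y \<in> L then - 1 else 0)"
      using above[of y] fx by (auto simp flip: of_int_diff)
    then have "C x y * of_int (f x - f y) \<le> C x y * (if y \<in> L then - 1 else 0)"
      using C by (intro mult_left_mono) auto
    then show "C x y * of_int (f x - f y) \<le> (if y \<in> L then - C x y else 0)"
      by (auto split: if_splits)
  qed
  also have "\<dots> = - (\<Sum>y\<in>L. C x y)"
    unfolding sum_negf[symmetric]
    by (rule sum.mono_neutral_cong_right) (use finite_nbrs in \<open>auto simp: L_def\<close>)
  finally have "nu V E C R x + lap f x \<le> - unit x"
    using xV by (simp add: nu_apply L_def)
  then have "nu V E C R x + lap f x < 0"
    using unit_pos[of x] by simp
  then show ?thesis
    using xV by (auto simp: effective_iff not_le)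
qed

section \<open>Potentials, reduced divisors and the burning process\<close>

text \<open>If no edge left \<open>S\<close>, a path from a point of \<open>S\<close> to a point
  outside would stay inside \<open>S\<close>, against connectedness.\<close>

lemma boundary_edge:
  assumes "S \<subseteq> V" "S \<noteq> {}" "S \<noteq> V"
  shows "\<exists>x\<in>V - S. \<exists>y\<in>S. y \<in> nbrs E x"
proof (rule ccontr)
  assume no: "\<not> ?thesis"
  obtain s t where st: "s \<in> S" "t \<in> V" "t \<notin> S"
    using assms by blast
  have "(s, t) \<in> {(u, v). {u, v} \<in> E}\<^sup>*"
    using connected st assms(1) by blast
  then have "t \<in> S"
  proof (induction rule: rtrancl_induct)
    case (step u v)
    then have "v \<in> nbrs E u" "u \<in> nbrs E v"
      by (auto simp: nbrs_def insert_commute)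
    then show ?case
      using no step.IH nbrs_subset by blast
  qed (rule st)
  with st show False by simp
qed

text \<open>Induction on the complement of \<open>S\<close>: move a vertex \<open>x\<close> adjacent
  to \<open>S\<close> into \<open>S\<close>, take the potential for the larger set, and repair it at
  \<open>x\<close> by adding a large multiple of the indicator of \<open>V - S\<close>. That
  indicator has positive Laplacian at \<open>x\<close> and nonnegative Laplacian on the rest of
  \<open>V - S\<close>.\<close>

lemma positive_potential:
  assumes "S \<subseteq> V" "S \<noteq> {}"
  shows "\<exists>h::'a \<Rightarrow> int. (\<forall>x. 0 \<le> h x) \<and> (\<forall>x\<in>S. h x = 0) \<and> (\<forall>x\<in>V - S. 0 < lap h x)"
  using assms
proof (induction "card (V - S)" arbitrary: S)
  case 0
  then have "V - S = {}"
    using finite_vertices by simp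
  then show ?case
    by (intro exI[of _ "\<lambda>_. 0"]) (simp only: ball_empty, simp)
next
  case (Suc n)
  then have "S \<noteq> V" by auto
  then obtain x y where x: "x \<in> V - S" and y: "y \<in> S" "y \<in> nbrs E x"
    using boundary_edge Suc.prems by blast
  have ins: "V - S = insert x (V - insert x S)"
    using x by auto
  have "card (V - S) = Suc (card (V - insert x S))"
    by (subst ins) (use finite_vertices in simp)
  then have "n = card (V - insert x S)"
    using Suc.hyps(2) by simp
  from Suc.hyps(1)[OF this] x Suc.prems
  obtain h :: "'a \<Rightarrow> int" where h: "\<And>v. 0 \<le> h v" "\<And>v. v \<in> insert x S \<Longrightarrow> h v = 0"
      "\<And>v. v \<in> V - insert x S \<Longrightarrow> 0 < lap h v"
    by blast
  define A where "A = V - S"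
  define g :: "'a \<Rightarrow> int" where "g v = (if v \<in> A then 1 else 0)" for v
  have lap_g: "lap g v = (\<Sum>z\<in>nbrs E v - A. C v z)" if "v \<in> A" for v
    using lap_indicator_inside[OF that] by (simp add: g_def[abs_def])
  have g_nonneg: "0 \<le> lap g v" if "v \<in> A" for v
    unfolding lap_g[OF that] by (intro sum_nonneg) (auto dest: nbrs_weight_pos)
  have g_pos: "0 < lap g x"
  proof -
    have "x \<in> A" using x by (simp add: A_def)
    show ?thesis
      unfolding lap_g[OF \<open>x \<in> A\<close>]
      by (rule sum_pos) (use y finite_nbrs nbrs_weight_pos in \<open>auto simp: A_def\<close>)
  qed
  \<comment> \<open>As \<open>h\<close> is nonnegative and vanishes at \<open>x\<close>,
    \<open>lap h x\<close> is never positive; \<open>K\<close> is chosen to outweigh it.\<close>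
  obtain K :: nat where K: "- lap h x < of_nat K * lap g x"
    using ex_less_of_nat_mult[OF g_pos] by blast
  define h' where "h' v = h v + int K * g v" for v
  have lap_h': "lap h' v = lap h v + of_nat K * lap g v" for v
    unfolding h'_def by (simp add: lap_add lap_scale)
  have "0 < lap h' v" if "v \<in> V - S" for v
  proof (cases "v = x")
    case True
    then show ?thesis using K lap_h' by simp
  next
    case False
    then have "0 < lap h v" "0 \<le> lap g v"
      using that h(3) g_nonneg by (auto simp: A_def)
    then show ?thesis
      unfolding lap_h' by (simp add: add_pos_nonneg)
  qed
  moreover have "\<forall>v\<in>S. h' v = 0" "\<forall>v. 0 \<le> h' v"
    using h by (auto simp: h'_def g_def A_def)
  ultimately show ?case by blast
qed

text \<open>The potential \<open>h\<close> makes an equivalent divisor nonnegative off \<open>q\<close>, and firing a set \<open>A\<close> lowers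
  \<open>\<Sum>x. D' x * h x\<close> by \<open>\<Sum>x\<in>A. lap h x > 0\<close>. These sums have a common denominator, so a minimum is
  attained.\<close>

lemma reduced_divisor_exists:
  assumes D: "divisor V E C D" and q: "q \<in> V"
  shows "\<exists>f. (\<forall>x\<in>V - {q}. 0 \<le> D x + lap f x) \<and>
    (\<forall>A. A \<subseteq> V - {q} \<longrightarrow> A \<noteq> {} \<longrightarrow>
      (\<exists>x\<in>A. D x + lap f x < (\<Sum>y\<in>nbrs E x - A. C x y)))"
proof -
  obtain h :: "'a \<Rightarrow> int" where h: "\<And>x. 0 \<le> h x" "h q = 0" "\<And>x. x \<in> V - {q} \<Longrightarrow> 0 < lap h x"
    using positive_potential[of "{q}"] q by auto
  define P where "P f \<longleftrightarrow> (\<forall>x\<in>V - {q}. 0 \<le> D x + lap f x)" for f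
  define \<Phi> where "\<Phi> f = (\<Sum>x\<in>V. (D x + lap f x) * of_int (h x))" for f
  obtain N :: int where N: "0 < N" "\<And>x. x \<in> V \<Longrightarrow> of_int N * unit x \<in> \<int>"
    using common_denominator[OF finite_vertices, of unit] by blast
  have \<Phi>_int: "of_int N * \<Phi> f \<in> \<int>" for f
  proof -
    have "of_int N * ((D x + lap f x) * of_int (h x)) \<in> \<int>" if x: "x \<in> V" for x
    proof -
      obtain k :: int where "D x + lap f x = of_int k * unit x"
        using divisor_unit_multiple[OF divisor_add_lap[OF D] x] by blast
      then have "of_int N * ((D x + lap f x) * of_int (h x)) =
          of_int N * unit x * of_int (k * h x)"
        by simp
      then show ?thesis
        by (simp only: Ints_mult[OF N(2)[OF x] Ints_of_int])
    qed
    then show ?thesis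
      unfolding \<Phi>_def sum_distrib_left by (rule Ints_sum)
  qed
  have \<Phi>_nonneg: "0 \<le> \<Phi> f" if "P f" for f
    unfolding \<Phi>_def
  proof (rule sum_nonneg)
    fix x assume "x \<in> V"
    then show "0 \<le> (D x + lap f x) * of_int (h x)"
      using that h by (cases "x = q") (auto simp: P_def)
  qed
  have "\<exists>f. P f"
  proof -
    have "\<exists>n::nat. - D x \<le> of_nat n * lap h x" if "x \<in> V - {q}" for x
      using ex_less_of_nat_mult[OF h(3)[OF that], of "- D x"] less_imp_le by blast
    then obtain n :: "'a \<Rightarrow> nat" where n: "\<And>x. x \<in> V - {q} \<Longrightarrow> - D x \<le> of_nat (n x) * lap h x"
      by metis
    \<comment> \<open>The sum dominates every threshold \<open>n x\<close>, so one multiple of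
      \<open>h\<close> works at all vertices.\<close>
    define K where "K = (\<Sum>x\<in>V. n x)"
    have "0 \<le> D x + lap (\<lambda>v. int K * h v) x" if x: "x \<in> V - {q}" for x
    proof -
      have "n x \<le> K"
        unfolding K_def using x finite_vertices by (intro member_le_sum) auto
      then have "of_nat (n x) * lap h x \<le> of_nat K * lap h x"
        using h(3)[OF x] by (intro mult_right_mono) auto
      then show ?thesis
        using n[OF x] by (simp add: lap_scale)
    qed
    then show ?thesis unfolding P_def by blast
  qed
  then obtain f where f: "P f"
      \<comment> \<open>On functions satisfying \<open>P\<close> the scaled \<open>\<Phi>\<close> is
        a nonnegative integer, so \<open>nat\<close> and the floor lose nothing.\<close>
      and fmin: "\<And>g. P g \<Longrightarrow> nat \<lfloor>of_int N * \<Phi> f\<rfloor> \<le> nat \<lfloor>of_int N * \<Phi> g\<rfloor>"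
    using ex_has_least_nat[of P _ "\<lambda>g. nat \<lfloor>of_int N * \<Phi> g\<rfloor>"] by blast
  have \<Phi>_min: "\<Phi> f \<le> \<Phi> g" if "P g" for g
  proof -
    have "0 \<le> \<lfloor>of_int N * \<Phi> g\<rfloor>"
      using \<Phi>_nonneg[OF that] N(1) by simp
    then have "\<lfloor>of_int N * \<Phi> f\<rfloor> \<le> \<lfloor>of_int N * \<Phi> g\<rfloor>"
      using fmin[OF that] by linarith
    then have "of_int N * \<Phi> f \<le> of_int N * \<Phi> g"
      using \<Phi>_int[of f] \<Phi>_int[of g] by (auto elim!: Ints_cases)
    then show ?thesis
      using N(1) by simp
  qed
  have "\<exists>x\<in>A. D x + lap f x < (\<Sum>y\<in>nbrs E x - A. C x y)" if A: "A \<subseteq> V - {q}" "A \<noteq> {}" for A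
  proof (rule ccontr)
    assume no: "\<not> ?thesis"
    define e :: "'a \<Rightarrow> int" where "e v = (if v \<in> A then 1 else 0)" for v
    \<comment> \<open>Subtracting the indicator fires \<open>A\<close>: each vertex of
      \<open>A\<close> pays the weight of its edges leaving \<open>A\<close>, and the vertices
      outside receive it. By \<open>no\<close>, every vertex of \<open>A\<close> can afford
      this.\<close>
    define g where "g v = f v - e v" for v
    have lap_g: "lap g x = lap f x - lap e x" for x
      unfolding g_def by (rule lap_diff)
    have "P g"
      unfolding P_def lap_g
    proof
      fix x assume x: "x \<in> V - {q}"
      show "0 \<le> D x + (lap f x - lap e x)"
      proof (cases "x \<in> A")
        case True
        then have "(\<Sum>y\<in>nbrs E x - A. C x y) \<le> D x + lap f x"
          using no by (meson not_le)
        then show ?thesis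
          using lap_indicator_inside[OF True] by (simp add: e_def[abs_def])
      next
        case False
        have "0 \<le> (\<Sum>y\<in>nbrs E x \<inter> A. C x y)"
          by (intro sum_nonneg) (auto dest: nbrs_weight_pos)
        moreover have "0 \<le> D x + lap f x"
          using f x by (simp add: P_def)
        ultimately show ?thesis
          using lap_indicator_outside[OF False] by (simp add: e_def[abs_def])
      qed
    qed
    have "\<Phi> g = \<Phi> f - (\<Sum>x\<in>V. lap e x * of_int (h x))"
      unfolding \<Phi>_def lap_g sum_subtractf[symmetric] by (simp add: algebra_simps)
    \<comment> \<open>Green's identity moves the Laplacian onto \<open>h\<close>, where it is
      positive on \<open>A\<close> because \<open>A\<close> avoids \<open>q\<close>.\<close>
    also have "(\<Sum>x\<in>V. lap e x * of_int (h x)) = (\<Sum>x\<in>V. of_int (e x) * lap h x)"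
      by (rule lap_green)
    also have "\<dots> = (\<Sum>x\<in>A. lap h x)"
      by (rule sum.mono_neutral_cong_right) (use A finite_vertices in \<open>auto simp: e_def\<close>)
    finally have "\<Phi> g = \<Phi> f - (\<Sum>x\<in>A. lap h x)" .
    moreover have "0 < (\<Sum>x\<in>A. lap h x)"
      by (rule sum_pos) (use A finite_vertices h(3) in \<open>auto intro: finite_subset\<close>)
    ultimately show False
      using \<Phi>_min[OF \<open>P g\<close>] by simp
  qed
  with f show ?thesis
    unfolding P_def by blast
qed

text \<open>Dhar's burning algorithm: \<open>S\<close> is the set already burnt, and a vertex catches fire once the
  weight of its edges to burnt vertices exceeds its value.\<close>

lemma burning_order:
  assumes unfireable: "\<And>A. A \<subseteq> V - {q} \<Longrightarrow> A \<noteq> {} \<Longrightarrow>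
      \<exists>x\<in>A. F x < (\<Sum>y\<in>nbrs E x - A. C x y)"
    and "S \<subseteq> V" "q \<in> S"
  shows "\<exists>R. linear_order_on (V - S) R \<and>
    (\<forall>x\<in>V - S. F x < (\<Sum>y\<in>{y \<in> nbrs E x. y \<in> S \<or> (y, x) \<in> R \<and> y \<noteq> x}. C x y))"
  using assms(2,3)
proof (induction "card (V - S)" arbitrary: S)
  case 0
  then have "V - S = {}"
    using finite_vertices by simp
  then show ?case
    by (intro exI[of _ "{}"]) (simp only: ball_empty, simp)
next
  case (Suc n)
  then have "V - S \<noteq> {}" by (metis card.empty nat.distinct(1))
  \<comment> \<open>The unburnt set cannot be fired, so some \<open>x\<close> in it has too small a
    value; its neighbours outside that set are exactly the burnt ones.\<close>
  then obtain x where x: "x \<in> V - S" and Fx: "F x < (\<Sum>y\<in>nbrs E x - (V - S). C x y)"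
    using unfireable[of "V - S"] Suc.prems by blast
  have ins: "V - S = insert x (V - insert x S)"
    using x by auto
  have "card (V - S) = Suc (card (V - insert x S))"
    by (subst ins) (use finite_vertices in simp)
  then have "n = card (V - insert x S)"
    using Suc.hyps(2) by simp
  from Suc.hyps(1)[OF this] x Suc.prems
  obtain R where R: "linear_order_on (V - insert x S) R"
    and FR: "\<And>v. v \<in> V - insert x S \<Longrightarrow>
      F v < (\<Sum>y\<in>{y \<in> nbrs E v. y \<in> insert x S \<or> (y, v) \<in> R \<and> y \<noteq> v}. C v y)"
    by blast
  \<comment> \<open>The vertex \<open>x\<close> burns before all remaining ones, hence goes to the
    bottom.\<close>
  define R' where "R' = R \<union> {x} \<times> insert x (V - insert x S)"
  have R': "linear_order_on (V - S) R'"
    unfolding R'_def ins by (rule linear_order_on_insert_bottom[OF R]) simp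
  have Rsub: "R \<subseteq> (V - insert x S) \<times> (V - insert x S)"
    using R by (auto simp: linear_order_on_def partial_order_on_def preorder_on_def refl_on_def)
  have "F v < (\<Sum>y\<in>{y \<in> nbrs E v. y \<in> S \<or> (y, v) \<in> R' \<and> y \<noteq> v}. C v y)" if v: "v \<in> V - S" for v
  proof (cases "v = x")
    case True
    have "{y \<in> nbrs E x. y \<in> S \<or> (y, x) \<in> R' \<and> y \<noteq> x} = nbrs E x - (V - S)"
      using Rsub nbrs_subset[of x] by (auto simp: R'_def)
    then show ?thesis
      using Fx True by simp
  next
    case False
    \<comment> \<open>For a later \<open>v\<close>, the vertex \<open>x\<close> counts either way:
      as burnt in the induction hypothesis, as smaller than \<open>v\<close> in
      \<open>R'\<close>.\<close>
    then have "{y \<in> nbrs E v. y \<in> S \<or> (y, v) \<in> R' \<and> y \<noteq> v} =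
        {y \<in> nbrs E v. y \<in> insert x S \<or> (y, v) \<in> R \<and> y \<noteq> v}"
      using v by (auto simp: R'_def)
    then show ?thesis
      using FR[of v] v False by simp
  qed
  with R' show ?case by blast
qed

section \<open>The two linear systems\<close>

text \<open>This discreteness turns the strict inequality of the burning process into the term
  \<open>- unit x\<close> of \<open>nu\<close>.\<close>

lemma unit_multiple_less:
  assumes "a = of_int k * unit x" "b = of_int l * unit x" "a < b"
  shows "a \<le> b - unit x"
proof -
  have "k < l"
    using assms unit_pos[of x] by simp
  then have "of_int (k + 1) * unit x \<le> of_int l * unit x"
    using unit_pos[of x] by (intro mult_right_mono) (auto simp only: of_int_le_iff)
  then show ?thesis
    using assms by (simp add: algebra_simps)
qed

lemma order_with_nonempty_system:
  assumes D: "divisor V E C D"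
  shows "\<exists>R. linear_order_on V R \<and>
    (linear_system V E C D \<noteq> {} \<or> linear_system V E C (\<lambda>x. nu V E C R x - D x) \<noteq> {})"
proof -
  obtain q where q: "q \<in> V"
    using nonempty_vertices by blast
  obtain f where f_nonneg: "\<And>x. x \<in> V - {q} \<Longrightarrow> 0 \<le> D x + lap f x"
    and f_red: "\<And>A. A \<subseteq> V - {q} \<Longrightarrow> A \<noteq> {} \<Longrightarrow>
      \<exists>x\<in>A. D x + lap f x < (\<Sum>y\<in>nbrs E x - A. C x y)"
    using reduced_divisor_exists[OF D q] by blast
  define F where "F x = D x + lap f x" for x
  have F: "divisor V E C F"
    using divisor_add_lap[OF D, of f] by (simp add: F_def[abs_def])
  obtain R0 where R0: "linear_order_on (V - {q}) R0"
    and FR0: "\<And>x. x \<in> V - {q} \<Longrightarrow>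
      F x < (\<Sum>y\<in>{y \<in> nbrs E x. y \<in> {q} \<or> (y, x) \<in> R0 \<and> y \<noteq> x}. C x y)"
    using burning_order[of q F "{q}"] f_red q unfolding F_def by blast
  \<comment> \<open>Burning started with \<open>q\<close> already burnt, so \<open>R0\<close> orders
    only the other vertices and \<open>q\<close> is put below them.\<close>
  define R where "R = R0 \<union> {q} \<times> insert q (V - {q})"
  have R: "linear_order_on V R"
    using linear_order_on_insert_bottom[OF R0, of q] q by (simp add: R_def insert_absorb)
  have R0sub: "R0 \<subseteq> (V - {q}) \<times> (V - {q})"
    using R0 by (auto simp: linear_order_on_def partial_order_on_def preorder_on_def refl_on_def)
  have "linear_system V E C D \<noteq> {} \<or> linear_system V E C (\<lambda>x. nu V E C R x - D x) \<noteq> {}"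
  proof (cases "0 \<le> F q")
    case True
    then have "effective V E C F"
      using F f_nonneg by (auto simp: effective_iff F_def)
    moreover have "lin_equiv E C F D"
      unfolding lin_equiv_def
      by (rule exI[of _ "\<lambda>v. - f v"]) (simp add: lap_uminus F_def)
    ultimately show ?thesis
      unfolding linear_system_def by blast
  next
    case False
    have "F x \<le> nu V E C R x" if x: "x \<in> V" for x
    proof -
      define L where "L = {y \<in> nbrs E x. (y, x) \<in> R \<and> y \<noteq> x}"
      have "F x < (\<Sum>y\<in>L. C x y)"
      proof (cases "x = q")
        case True
        \<comment> \<open>Nothing lies below \<open>q\<close>, so its sum is 0 and the case
          assumption \<open>F q < 0\<close> supplies the strict inequality.\<close>
        have "L = {}"
          using R0sub True by (auto simp: L_def R_def)
        then show ?thesis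
          using False True by simp
      next
        case False
        have "L = {y \<in> nbrs E x. y \<in> {q} \<or> (y, x) \<in> R0 \<and> y \<noteq> x}"
          using False x by (auto simp: L_def R_def)
        then show ?thesis
          using FR0[of x] x False by simp
      qed
      moreover obtain k :: int where "F x = of_int k * unit x"
        using divisor_unit_multiple[OF F x] by blast
      moreover obtain l :: int where "(\<Sum>y\<in>L. C x y) = of_int l * unit x"
        using weight_sum_unit_multiple[of L x] by (auto simp: L_def)
      ultimately have "F x \<le> (\<Sum>y\<in>L. C x y) - unit x"
        using unit_multiple_less by blast
      then show ?thesis
        using x by (simp add: nu_apply L_def)
    qed
    then have "effective V E C (\<lambda>x. nu V E C R x - F x)"
      using divisor_diff[OF divisor_nu F] by (auto simp: effective_iff)
    moreover have "lin_equiv E C (\<lambda>x. nu V E C R x - F x) (\<lambda>x. nu V E C R x - D x)"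
      unfolding lin_equiv_def by (rule exI[of _ f]) (simp add: F_def)
    ultimately show ?thesis
      unfolding linear_system_def by blast
  qed
  with R show ?thesis by blast
qed

text \<open>Effective members of the two systems would add up to an effective divisor equivalent to
  \<open>nu\<close>, which \<open>nu_add_lap_not_effective\<close> excludes.\<close>

lemma linear_systems_not_both_nonempty:
  assumes R: "linear_order_on V R"
  shows "linear_system V E C D = {} \<or> linear_system V E C (\<lambda>x. nu V E C R x - D x) = {}"
proof (rule ccontr)
  assume "\<not> ?thesis"
  then obtain A B where "A \<in> linear_system V E C D"
    "B \<in> linear_system V E C (\<lambda>x. nu V E C R x - D x)"
    by auto
  then have eff: "effective V E C A" "effective V E C B"
    and equiv: "lin_equiv E C A D" "lin_equiv E C B (\<lambda>x. nu V E C R x - D x)"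
    unfolding linear_system_def by auto
  from equiv obtain f g where D: "\<And>x. D x = A x + lap f x"
    and nD: "\<And>x. nu V E C R x - D x = B x + lap g x"
    unfolding lin_equiv_def fun_eq_iff by auto
  \<comment> \<open>Adding the two equivalences cancels \<open>D\<close>; moving both Laplacians to
    the other side gives the minus sign.\<close>
  have "A x + B x = nu V E C R x + lap (\<lambda>v. - (f v + g v)) x" for x
    using D[of x] nD[of x] unfolding lap_uminus lap_add by simp
  then show False
    using effective_add[OF eff] nu_add_lap_not_effective[OF R, of "\<lambda>v. - (f v + g v)"] by simp
qed

end

theorem theorem2p7:
  fixes V :: "'a set" and E :: "'a set set" and C :: "'a \<Rightarrow> 'a \<Rightarrow> rat" and D :: "'a \<Rightarrow> rat"
  assumes "weighted_graph V E C" and "divisor V E C D"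
  shows "\<exists>R. linear_order_on V R \<and>
    (linear_system V E C D = {}) \<noteq> (linear_system V E C (\<lambda>x. nu V E C R x - D x) = {})"
proof -
  interpret weighted_graph V E C by fact
  show ?thesis
    using order_with_nonempty_system[OF assms(2)] linear_systems_not_both_nonempty by metis
qed

end
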